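(* Let $n\ge 1$, let $f:\{0,1\}^n\to\{1,-1\}$ be a Boolean function, let $S\subseteq\{0,1\}^n$, and let $g:\{0,1\}^n\to\{1,-1\}$ be defined by $g(\mathbf{x})=-1$ for all $\mathbf{x}\in S$ and $g(\mathbf{x})=1$ otherwise. Then the probability of getting the output $1$ upon running the algorithm $\mathcal{A}^{(3,2)}(f,g,f)$ is equal to $$p=\frac{1}{2^{2n}}\sum_{\mathbf{x}\in S}W_f(\mathbf{x})^2 .$$
   Context: The Walsh transform of $f:\{0,1\}^n\to\{1,-1\}$ is $W_f(\boldsymbol{\omega})=\sum_{\mathbf{x}\in\{0,1\}^n}f(\mathbf{x})(-1)^{\mathbf{x}\cdot\boldsymbol{\omega}}$, where $\mathbf{x}\cdot\boldsymbol{\omega}=x_1\omega_1\oplus\cdots\oplus x_n\omega_n$. The oracle $U_h$ of a function $h:\{0,1\}^n\to\{1,-1\}$ is the unitary on $n+1$ qubits given by $U_h|\mathbf{x}\rangle|a\rangle=|\mathbf{x}\rangle\left|a\oplus\frac{1-h(\mathbf{x})}{2}\right\rangle$; in particular $U_h|\mathbf{x}\rangle|-\rangle=h(\mathbf{x})|\mathbf{x}\rangle|-\rangle$. Here $|\pm\rangle=\frac{1}{\sqrt2}(|0\rangle\pm|1\rangle)$ and $H$ is the $2\times2$ (normalized) Hadamard gate. The algorithm $\mathcal{A}^{(3,2)}(f_1,f_2,f_3)$, for $f_1,f_2,f_3:\{0,1\}^n\to\{1,-1\}$: start from the $(n+2)$-qubit state $|+\rangle|0\rangle^{\otimes n}|-\rangle$,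 whose first qubit is the driving qubit and whose next $n$ qubits are the query register. Controlled on the driving qubit being in state $|0\rangle$, apply to the remaining $n+1$ qubits, in this order, $H^{\otimes n}$, $U_{f_1}$, $H^{\otimes n}$, $U_{f_2}$, $H^{\otimes n}$; controlled on the driving qubit being in state $|1\rangle$, apply to the remaining $n+1$ qubits, in this order, $H^{\otimes n}$, $U_{f_3}$ (each $H^{\otimes n}$ acts on the query register). Finally apply $H$ to the driving qubit and measure it in the computational basis; the measured bit is the output. *)

theory Defs
  imports "HOL-Analysis.Analysis" "HOL-Library.Z2"
begin

(* Bits are elements of the two-element field bit, whose addition is XOR. An n-bit string is an
   element of bit^'n with n = CARD('n) >= 1. A system with computational basis 'b has state space
   complex^'b; the product of two systems is indexed by pairs of basis labels. Gates are complex
   matrices with first index the row (output) and second index the column (input). *)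

instance bit :: finite
proof
  have "(UNIV :: bit set) \<subseteq> {0, 1}"
    by (metis bit_not_one_iff insertCI subsetI)
  then show "finite (UNIV :: bit set)"
    by (rule finite_subset) simp
qed

definition bit_sign :: "bit \<Rightarrow> 'a::comm_ring_1"  \<comment> \<open>\<open>(-1)\<close> to the power of a bit\<close>
  where "bit_sign b = (-1) ^ (if b = 1 then 1 else 0)"

definition bit_dot :: "bit ^ 'n \<Rightarrow> bit ^ 'n \<Rightarrow> bit"  (infix "\<bullet>\<^sub>2" 70)
  where "x \<bullet>\<^sub>2 w = (\<Sum>i\<in>UNIV. x $ i * w $ i)"

definition walsh :: "(bit ^ 'n \<Rightarrow> int) \<Rightarrow> bit ^ 'n \<Rightarrow> int"
  where "walsh f w = (\<Sum>x\<in>UNIV. f x * bit_sign (x \<bullet>\<^sub>2 w))"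


definition ket :: "'b \<Rightarrow> complex ^ 'b"
  where "ket b = axis b 1"

definition ket_plus :: "complex ^ bit"
  where "ket_plus = (1 / sqrt 2) *\<^sub>R (ket 0 + ket 1)"

definition ket_minus :: "complex ^ bit"
  where "ket_minus = (1 / sqrt 2) *\<^sub>R (ket 0 - ket 1)"

definition tensor_vec :: "complex ^ 'a::finite \<Rightarrow> complex ^ 'b::finite \<Rightarrow> complex ^ ('a \<times> 'b)"  (infixr "\<otimes>\<^sub>v" 75)
  where "u \<otimes>\<^sub>v v = (\<chi> i. u $ fst i * v $ snd i)"

definition tensor_mat ::
    "complex ^ 'a ^ 'a \<Rightarrow> complex ^ 'b ^ 'b \<Rightarrow> complex ^ ('a \<times> 'b) ^ ('a \<times> 'b)"  (infixr "\<otimes>\<^sub>m" 75)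
  where "A \<otimes>\<^sub>m B = (\<chi> i j. A $ fst i $ fst j * B $ snd i $ snd j)"

definition tensor_power :: "complex ^ bit ^ bit \<Rightarrow> complex ^ (bit ^ 'n) ^ (bit ^ 'n)"
  where "tensor_power A = (\<chi> x y. \<Prod>i\<in>UNIV. A $ (x $ i) $ (y $ i))"

definition basis_proj :: "'b \<Rightarrow> complex ^ 'b ^ 'b"
  where "basis_proj b = (\<chi> i j. if i = b \<and> j = b then 1 else 0)"

definition hadamard :: "complex ^ bit ^ bit"
  where "hadamard = (1 / sqrt 2) *\<^sub>R (\<chi> i j. bit_sign (i * j))"

definition hadamard_query :: "complex ^ ((bit ^ 'n) \<times> bit) ^ ((bit ^ 'n) \<times> bit)"
  where "hadamard_query = tensor_power hadamard \<otimes>\<^sub>m mat 1"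

(* For h with values in {1, -1} the integer division by 2 is exact. *)
definition oracle_gate :: "(bit ^ 'n \<Rightarrow> int) \<Rightarrow> complex ^ ((bit ^ 'n) \<times> bit) ^ ((bit ^ 'n) \<times> bit)"
  where "oracle_gate h =
    (\<chi> i j. case j of (x, a) \<Rightarrow> if i = (x, a + of_int ((1 - h x) div 2)) then 1 else 0)"

lemma oracle_gate_ket:
  "oracle_gate h *v ket (x, a) = ket (x, a + of_int ((1 - h x) div 2))"
  by (simp add: oracle_gate_def ket_def matrix_vector_mult_def axis_def if_distrib[of "(*) _"]
      del: add_bit_eq_xor cong: if_cong)

lemma ket_pair: "ket x \<otimes>\<^sub>v ket a = ket (x, a)"
  by (auto simp: tensor_vec_def ket_def axis_def vec_eq_iff)

lemma oracle_gate_ket_minus: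
  assumes "h x \<in> {1, -1}"
  shows "oracle_gate h *v (ket x \<otimes>\<^sub>v ket_minus) = of_int (h x) *s (ket x \<otimes>\<^sub>v ket_minus)"
proof -
  have m: "ket x \<otimes>\<^sub>v ket_minus = of_real (1 / sqrt 2) *s (ket (x, 0) - ket (x, 1))"
    by (auto simp: ket_minus_def tensor_vec_def ket_def axis_def vec_eq_iff scaleR_conv_of_real[where 'a = complex])
  have "oracle_gate h *v (ket x \<otimes>\<^sub>v ket_minus)
      = of_real (1 / sqrt 2) *s (ket (x, of_int ((1 - h x) div 2)) - ket (x, 1 + of_int ((1 - h x) div 2)))"
    unfolding m by (simp only: vector_scalar_commute matrix_vector_mult_diff_distrib oracle_gate_ket add_0_left)
  also have "\<dots> = of_int (h x) *s (ket x \<otimes>\<^sub>v ket_minus)"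
    using assms unfolding m by (auto simp: vec_eq_iff)
  finally show ?thesis .
qed

definition controlled :: "bit \<Rightarrow> complex ^ 'b ^ 'b \<Rightarrow> complex ^ (bit \<times> 'b) ^ (bit \<times> 'b)"
  where "controlled c U = basis_proj c \<otimes>\<^sub>m U + basis_proj (c + 1) \<otimes>\<^sub>m mat 1"

(* Born rule: probability of the outcome b when the first factor is measured in the
   computational basis. *)
definition prob_outcome :: "bit \<Rightarrow> complex ^ (bit \<times> 'b::finite) \<Rightarrow> real"
  where "prob_outcome b \<psi> = (norm ((basis_proj b \<otimes>\<^sub>m mat 1) *v \<psi>))\<^sup>2"

(* The tensor factors are, in order, the driving qubit, the query register and the target qubit
   of the oracle gates. Matrix products are applied from right to left. *)
definition initial_state :: "complex ^ (bit \<times> (bit ^ 'n) \<times> bit)"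
  where "initial_state = ket_plus \<otimes>\<^sub>v ket 0 \<otimes>\<^sub>v ket_minus"

definition final_state :: "(bit ^ 'n \<Rightarrow> int) \<Rightarrow> (bit ^ 'n \<Rightarrow> int) \<Rightarrow> (bit ^ 'n \<Rightarrow> int) \<Rightarrow>
    complex ^ (bit \<times> (bit ^ 'n) \<times> bit)"
  where "final_state f1 f2 f3 =
    ((hadamard \<otimes>\<^sub>m mat 1) **
     controlled 1 (oracle_gate f3 ** hadamard_query) **
     controlled 0 (hadamard_query ** oracle_gate f2 ** hadamard_query ** oracle_gate f1 ** hadamard_query))
    *v initial_state"

definition output_prob :: "bit \<Rightarrow> (bit ^ 'n \<Rightarrow> int) \<Rightarrow> (bit ^ 'n \<Rightarrow> int) \<Rightarrow> (bit ^ 'n \<Rightarrow> int) \<Rightarrow> real"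
  where "output_prob b f1 f2 f3 = prob_outcome b (final_state f1 f2 f3)"

end

theory Submission
  imports Defs
begin

text \<open>
  Let \<open>D h\<close> be the diagonal phase of \<open>h\<close> on the query register and \<open>H\<close> the \<open>n\<close>-fold Hadamard
  transform. By interference, the amplitude of output 1 is half of \<open>H (D g) H (D f) u - (D f) u\<close>
  with \<open>u = H |0>\<close>. As \<open>H\<close> is an involution, this difference is \<open>H (D g v - v)\<close> for
  \<open>v = H (D f) u\<close>, and \<open>H\<close> preserves norms. Now \<open>D g v - v\<close> is \<open>-2 v\<close> on \<open>S\<close> and 0 elsewhere,
  and the entries of \<open>v\<close> are the Walsh coefficients of \<open>f\<close> divided by \<open>2 ^ n\<close>.
\<close>

lemma bit_0_or_1: "(b::bit) = 0 \<or> b = 1"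
  by (metis bit_not_one_iff)

lemma UNIV_bit: "(UNIV :: bit set) = {0, 1}"
  using bit_0_or_1 by auto

lemma bit_sign_0 [simp]: "bit_sign 0 = 1"
  and bit_sign_1 [simp]: "bit_sign 1 = - 1"
  by (simp_all add: bit_sign_def)

lemma bit_sign_add: "bit_sign (a + b) = bit_sign a * bit_sign b"
  using bit_0_or_1[of a] bit_0_or_1[of b] by auto

lemma bit_sign_sum: "bit_sign (sum h A) = (\<Prod>i\<in>A. bit_sign (h i))"
  \<comment> \<open>Addition on \<open>bit\<close> must not be rewritten to XOR, or
    \<open>bit_sign_add\<close> no longer matches. For infinite \<open>A\<close> both sides take
    their default value, 1.\<close>
  by (induction A rule: infinite_finite_induct)
    (simp_all add: bit_sign_add del: add_bit_eq_xor)

lemma of_int_bit_sign [simp]: "of_int (bit_sign b) = bit_sign b"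
  using bit_0_or_1[of b] by auto

lemma bit_dot_commute: "x \<bullet>\<^sub>2 y = y \<bullet>\<^sub>2 x"
  unfolding bit_dot_def by (intro sum.cong refl mult.commute)

lemma bit_dot_0 [simp]: "x \<bullet>\<^sub>2 0 = 0"
  by (simp add: bit_dot_def)

lemma tensor_vec_diff_right: "u \<otimes>\<^sub>v (v - w) = u \<otimes>\<^sub>v v - u \<otimes>\<^sub>v w"
  by (simp add: tensor_vec_def vec_eq_iff algebra_simps)

lemma tensor_vec_add_left: "(u + v) \<otimes>\<^sub>v w = u \<otimes>\<^sub>v w + v \<otimes>\<^sub>v w"
  and tensor_vec_diff_left: "(u - v) \<otimes>\<^sub>v w = u \<otimes>\<^sub>v w - v \<otimes>\<^sub>v w"
  and tensor_vec_minus_left: "(- u) \<otimes>\<^sub>v w = - (u \<otimes>\<^sub>v w)"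
  and tensor_vec_scaleR_left: "(r *\<^sub>R u) \<otimes>\<^sub>v w = r *\<^sub>R (u \<otimes>\<^sub>v w)"
  by (simp_all add: tensor_vec_def vec_eq_iff algebra_simps)

lemma tensor_mat_vec: "(A \<otimes>\<^sub>m B) *v (u \<otimes>\<^sub>v v) = (A *v u) \<otimes>\<^sub>v (B *v v)"
  by (simp add: vec_eq_iff tensor_mat_def tensor_vec_def matrix_vector_mult_def sum_product
      UNIV_Times_UNIV[symmetric] sum.cartesian_product case_prod_beta ac_simps
      del: UNIV_Times_UNIV)

lemma matrix_vector_mult_scaleR_complex:
  fixes A :: "complex ^ 'b ^ 'c"
  shows "A *v (r *\<^sub>R w) = r *\<^sub>R (A *v w)"
  by (simp add: vec_eq_iff matrix_vector_mult_def scaleR_sum_right)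

lemma norm_power2_vec: "(norm (v :: complex ^ 'b))\<^sup>2 = (\<Sum>i\<in>UNIV. (cmod (v $ i))\<^sup>2)"
  by (simp add: norm_vec_def L2_set_def sum_nonneg)

lemma norm_tensor_vec: "norm (u \<otimes>\<^sub>v v) = norm u * norm v"
proof -
  have "(norm (u \<otimes>\<^sub>v v))\<^sup>2 = (norm u)\<^sup>2 * (norm v)\<^sup>2"
    by (simp add: norm_power2_vec tensor_vec_def norm_mult power_mult_distrib sum_product
        UNIV_Times_UNIV[symmetric] sum.cartesian_product case_prod_beta
        del: UNIV_Times_UNIV)
  then show ?thesis
    by (simp add: power_mult_distrib[symmetric])
qed

lemma norm_ket [simp]: "norm (ket b) = 1"
  by (simp add: ket_def norm_axis_1)

lemma norm_ket_minus: "norm ket_minus = 1"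
proof -
  have "(norm ket_minus)\<^sup>2 = 1"
    by (simp add: norm_power2_vec UNIV_bit ket_minus_def ket_def axis_def power_divide)
  then show ?thesis
    \<comment> \<open>The other square root, -1, is excluded because norms are nonnegative.\<close>
    by (simp add: power2_eq_1_iff) (use norm_ge_zero[of ket_minus] in linarith)
qed

lemma basis_proj_ket: "basis_proj b *v ket c = (if b = c then ket c else 0)"
  by (auto simp: vec_eq_iff basis_proj_def ket_def matrix_vector_mult_def axis_def
      if_distrib[of "(*) _"] cong: if_cong)

text \<open>The bits \<open>c\<close> and \<open>c + 1\<close> are the two distinct basis labels, so
  exactly one of the two projected summands survives.\<close>

lemma controlled_ket:
  "controlled c U *v (ket b \<otimes>\<^sub>v w) = ket b \<otimes>\<^sub>v (if b = c then U *v w else w)"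
proof -
  have z: "0 \<otimes>\<^sub>v y = 0" for y :: "complex ^ 'b"
    by (simp add: tensor_vec_def vec_eq_iff)
  show ?thesis
    using bit_0_or_1[of b] bit_0_or_1[of c]
    by (auto simp: controlled_def matrix_vector_mult_add_rdistrib tensor_mat_vec basis_proj_ket z)
qed

text \<open>Source of the interference: the row of \<open>hadamard\<close> for outcome 1 has entries
  of opposite sign, so the two branches get subtracted.\<close>

lemma basis_proj_1_hadamard_ket:
  "basis_proj 1 *v (hadamard *v ket b) = (bit_sign b / sqrt 2) *\<^sub>R ket 1"
  by (auto simp: vec_eq_iff matrix_vector_mult_def basis_proj_def hadamard_def ket_def axis_def
      UNIV_bit scaleR_conv_of_real[where 'a = complex] bit_sign_def)

text \<open>Distributivity: expanding a product of sums means choosing one summand per coordinate,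
  and such choices are exactly the vectors.\<close>

lemma sum_vec_prod:
  fixes F :: "'n::finite \<Rightarrow> 'b::finite \<Rightarrow> 'a::comm_semiring_1"
  shows "(\<Sum>y\<in>(UNIV :: ('b ^ 'n) set). \<Prod>i\<in>UNIV. F i (y $ i)) = (\<Prod>i\<in>UNIV. \<Sum>b\<in>UNIV. F i b)"
proof -
  have "bij_betw vec_nth (UNIV :: ('b ^ 'n) set) (UNIV :: ('n \<Rightarrow> 'b) set)"
    by (rule bij_betwI[where g = vec_lambda]) auto
  then have "(\<Sum>y\<in>(UNIV :: ('b ^ 'n) set). \<Prod>i\<in>UNIV. F i (y $ i)) = (\<Sum>h\<in>UNIV. \<Prod>i\<in>UNIV. F i (h i))"
    by (rule sum.reindex_bij_betw[where g = "\<lambda>h. \<Prod>i\<in>UNIV. F i (h i)"])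
  also have "\<dots> = (\<Prod>i\<in>UNIV. \<Sum>b\<in>UNIV. F i b)"
    using prod_sum_PiE[of UNIV "\<lambda>_. UNIV" F] by (simp add: PiE_UNIV_domain)
  finally show ?thesis .
qed

text \<open>In each entry, the sum over intermediate strings factors into one sum per coordinate.
  This reduces facts about the n-qubit transform to the single gate.\<close>

lemma tensor_power_mult: "tensor_power A ** tensor_power B = tensor_power (A ** B)"
  (is "?L = ?R")
proof -
  have "?L $ x $ z = ?R $ x $ z" for x z
    using sum_vec_prod[of "\<lambda>i b. A $ (x $ i) $ b * B $ b $ (z $ i)"]
    by (simp add: tensor_power_def matrix_matrix_mult_def prod.distrib[symmetric])
  then show ?thesis
    by (simp add: vec_eq_iff)
qed

lemma tensor_power_mat_1: "tensor_power (mat 1) = mat 1"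
  by (auto simp: vec_eq_iff tensor_power_def mat_def prod_zero_iff)

lemma hadamard_involution: "hadamard ** hadamard = mat 1"
proof -
  have half: "complex_of_real (1 / sqrt 2) * complex_of_real (1 / sqrt 2) = 1 / 2"
    by (simp flip: of_real_mult of_real_divide) simp
  have "(hadamard ** hadamard) $ i $ j = mat 1 $ i $ j" for i j
    using bit_0_or_1[of i] bit_0_or_1[of j]
    by (auto simp: matrix_matrix_mult_def hadamard_def mat_def UNIV_bit half
        scaleR_conv_of_real[where 'a = complex] simp del: of_real_divide)
  then show ?thesis
    by (simp add: vec_eq_iff)
qed

lemma tensor_power_hadamard_involution: "tensor_power hadamard ** tensor_power hadamard = mat 1"
  by (simp add: tensor_power_mult hadamard_involution tensor_power_mat_1)

text \<open>The signs contributed by the coordinates multiply to the sign of the XOR of the bit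
  products, which is the kernel of the Walsh transform.\<close>

lemma tensor_power_hadamard_nth:
  fixes x y :: "bit ^ 'n"
  shows "tensor_power hadamard $ x $ y = of_real ((1 / sqrt 2) ^ CARD('n) * bit_sign (x \<bullet>\<^sub>2 y))"
proof -
  have "hadamard $ a $ b = of_real (1 / sqrt 2 * bit_sign (a * b))" for a b
    by (simp add: hadamard_def scaleR_conv_of_real[where 'a = complex] bit_sign_def)
  then show ?thesis
    by (simp only: tensor_power_def vec_lambda_beta bit_dot_def bit_sign_sum of_real_prod[symmetric]
        prod.distrib prod_constant)
qed

text \<open>A real symmetric matrix is its own adjoint, so if it is also its own inverse, it is
  unitary.\<close>

lemma norm_symmetric_involution:
  fixes M :: "complex ^ 'b ^ 'b"
  assumes real: "\<And>x y. cnj (M $ x $ y) = M $ x $ y"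
    and sym: "\<And>x y. M $ x $ y = M $ y $ x"
    and inv: "M ** M = mat 1"
  shows "norm (M *v v) = norm v"
proof -
  have MM: "(\<Sum>x\<in>UNIV. M $ y $ x * M $ x $ z) = (if y = z then 1 else 0)" for y z
    using arg_cong[OF inv, of "\<lambda>A. A $ y $ z"] by (simp add: matrix_matrix_mult_def mat_def)
  have norm2: "complex_of_real ((norm w)\<^sup>2) = (\<Sum>x\<in>UNIV. w $ x * cnj (w $ x))" for w :: "complex ^ 'b"
    by (simp add: norm_power2_vec complex_norm_square del: of_real_power)
  have "complex_of_real ((norm (M *v v))\<^sup>2)
      = (\<Sum>x\<in>UNIV. \<Sum>y\<in>UNIV. \<Sum>z\<in>UNIV. v $ y * cnj (v $ z) * (M $ y $ x * M $ x $ z))"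
    unfolding norm2
    by (simp add: matrix_vector_mult_def sum_product real sym[of _ "_::'b"] ac_simps)
  \<comment> \<open>With \<open>x\<close> innermost, that sum is an entry of \<open>M ** M\<close>,
    and \<open>MM\<close> leaves only the terms with \<open>y = z\<close>.\<close>
  also have "\<dots> = (\<Sum>y\<in>UNIV. \<Sum>z\<in>UNIV. \<Sum>x\<in>UNIV. v $ y * cnj (v $ z) * (M $ y $ x * M $ x $ z))"
    by (subst sum.swap) (intro sum.cong refl sum.swap)
  also have "\<dots> = complex_of_real ((norm v)\<^sup>2)"
    by (simp add: sum_distrib_left[symmetric] MM norm2 if_distrib[of "(*) _"] del: of_real_power cong: if_cong)
  finally have "(norm (M *v v))\<^sup>2 = (norm v)\<^sup>2"
    using of_real_eq_iff by blast
  then show ?thesis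
    by simp
qed

lemma norm_tensor_power_hadamard: "norm (tensor_power hadamard *v v) = norm v"
  by (rule norm_symmetric_involution)
    (simp_all add: tensor_power_hadamard_involution tensor_power_hadamard_nth bit_dot_commute)

text \<open>What the oracle does to the query register alone while the target qubit is in state
  \<open>ket_minus\<close>.\<close>

definition phase :: "(bit ^ 'n \<Rightarrow> int) \<Rightarrow> complex ^ (bit ^ 'n) \<Rightarrow> complex ^ (bit ^ 'n)"
  where "phase h u = (\<chi> x. of_int (h x) * u $ x)"

text \<open>Phase kickback, extended by linearity from basis states of the query register to
  superpositions.\<close>

lemma oracle_gate_tensor_ket_minus:
  assumes "\<And>x. h x \<in> {1, -1}"
  shows "oracle_gate h *v (u \<otimes>\<^sub>v ket_minus) = phase h u \<otimes>\<^sub>v ket_minus"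
proof -
  have expand: "w \<otimes>\<^sub>v ket_minus = (\<Sum>x\<in>UNIV. (w $ x) *s (ket x \<otimes>\<^sub>v ket_minus))"
    (is "?l = ?r") for w :: "complex ^ (bit ^ 'n)"
  proof -
    have "?l $ i = ?r $ i" for i
      by (simp add: tensor_vec_def ket_def axis_def if_distrib[of "(*) _"]
          if_distrib[of "\<lambda>c. c * _"] cong: if_cong)
    then show ?thesis
      by (simp only: vec_eq_iff) simp
  qed
  have "oracle_gate h *v (u \<otimes>\<^sub>v ket_minus)
      = (\<Sum>x\<in>UNIV. (u $ x) *s (oracle_gate h *v (ket x \<otimes>\<^sub>v ket_minus)))"
    by (simp add: expand[of u] vec.sum vector_scalar_commute)
  also have "\<dots> = phase h u \<otimes>\<^sub>v ket_minus"
    unfolding expand[of "phase h u"]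
    by (simp add: oracle_gate_ket_minus[OF assms] phase_def vector_smult_assoc mult.commute)
  finally show ?thesis .
qed

lemma hadamard_query_tensor:
  "hadamard_query *v (u \<otimes>\<^sub>v w) = (tensor_power hadamard *v u) \<otimes>\<^sub>v w"
  by (simp add: hadamard_query_def tensor_mat_vec)

text \<open>The first transform yields the uniform superposition; the second sums the values of
  \<open>f\<close> against the signs. Their two normalizations multiply to
  \<open>1 / 2 ^ CARD('n)\<close>.\<close>

lemma walsh_amplitude:
  fixes f :: "bit ^ 'n \<Rightarrow> int"
  shows "(tensor_power hadamard *v phase f (tensor_power hadamard *v ket 0)) $ x
    = of_real (of_int (walsh f x) / 2 ^ CARD('n))"
proof -
  have u: "(tensor_power hadamard *v ket 0) $ y = of_real ((1 / sqrt 2) ^ CARD('n))" for y :: "bit ^ 'n"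
    by (simp add: ket_def matrix_vector_mult_def axis_def if_distrib[of "(*) _"]
        tensor_power_hadamard_nth cong: if_cong)
  have s: "(1 / sqrt 2) ^ CARD('n) * (1 / sqrt 2) ^ CARD('n) = 1 / 2 ^ CARD('n)"
    by (simp add: power_mult_distrib[symmetric] power_divide)
  have "(tensor_power hadamard *v phase f (tensor_power hadamard *v ket 0)) $ x
      = of_real (\<Sum>y\<in>UNIV. ((1 / sqrt 2) ^ CARD('n) * (1 / sqrt 2) ^ CARD('n))
          * (of_int (f y) * bit_sign (y \<bullet>\<^sub>2 x)))"
    unfolding phase_def u
    by (simp add: matrix_vector_mult_def tensor_power_hadamard_nth bit_dot_commute[of x] ac_simps)
  also have "\<dots> = of_real (of_int (walsh f x) / 2 ^ CARD('n))"
    by (simp add: s walsh_def sum_divide_distrib)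
  finally show ?thesis .
qed

text \<open>The target qubit stays in \<open>ket_minus\<close> throughout and factors out with norm
  1. Preparing the driving qubit and its last Hadamard gate each give \<open>1 / sqrt 2\<close>,
  whence 1/4 after squaring.\<close>

lemma output_prob_interference:
  fixes f1 f2 f3 :: "bit ^ 'n \<Rightarrow> int"
  assumes f1: "\<And>x. f1 x \<in> {1, -1}" and f2: "\<And>x. f2 x \<in> {1, -1}" and f3: "\<And>x. f3 x \<in> {1, -1}"
  defines "u \<equiv> tensor_power hadamard *v ket 0"
  shows "output_prob 1 f1 f2 f3
    = (norm (tensor_power hadamard *v phase f2 (tensor_power hadamard *v phase f1 u) - phase f3 u))\<^sup>2 / 4"
proof -
  define a where "a = tensor_power hadamard *v phase f2 (tensor_power hadamard *v phase f1 u)"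
  define b where "b = phase f3 u"
  define m where "m = (ket_minus :: complex ^ bit)"
  have init: "initial_state = (1 / sqrt 2) *\<^sub>R (ket 0 \<otimes>\<^sub>v ket 0 \<otimes>\<^sub>v m + ket 1 \<otimes>\<^sub>v ket (0::bit ^ 'n) \<otimes>\<^sub>v m)"
    by (simp add: initial_state_def ket_plus_def m_def tensor_vec_scaleR_left tensor_vec_add_left)
  \<comment> \<open>Each controlled gate changes one branch and fixes the other, so the branches
    evolve separately to \<open>a\<close> and \<open>b\<close>. Without \<open>insert_iff\<close>,
    the oracle side conditions keep the form of the hypotheses.\<close>
  have fin: "final_state f1 f2 f3 = (1 / sqrt 2) *\<^sub>R
      ((hadamard *v ket 0) \<otimes>\<^sub>v a \<otimes>\<^sub>v m + (hadamard *v ket 1) \<otimes>\<^sub>v b \<otimes>\<^sub>v m)"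
    by (simp add: final_state_def init matrix_vector_mult_scaleR_complex
        matrix_vector_right_distrib controlled_ket tensor_mat_vec
        matrix_vector_mul_assoc[symmetric] hadamard_query_tensor m_def oracle_gate_tensor_ket_minus
        f1 f2 f3 a_def b_def u_def del: insert_iff)
  have "(basis_proj 1 \<otimes>\<^sub>m mat 1) *v final_state f1 f2 f3 = (1 / 2) *\<^sub>R (ket 1 \<otimes>\<^sub>v (a - b) \<otimes>\<^sub>v m)"
    by (simp add: fin matrix_vector_mult_scaleR_complex matrix_vector_right_distrib tensor_mat_vec
        basis_proj_1_hadamard_ket tensor_vec_scaleR_left tensor_vec_minus_left tensor_vec_diff_left
        tensor_vec_diff_right scaleR_diff_right)
  then show ?thesis
    unfolding a_def[symmetric] b_def[symmetric]
    by (simp add: output_prob_def prob_outcome_def norm_tensor_vec m_def norm_ket_minus power_divide)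
qed

theorem lemma3:
  fixes f g :: "bit ^ 'n \<Rightarrow> int" and S :: "(bit ^ 'n) set"
  assumes "\<And>x. f x \<in> {1, -1}"
    and "\<And>x. g x = (if x \<in> S then -1 else 1)"
  shows "output_prob 1 f g f = 1 / 2 ^ (2 * CARD('n)) * (\<Sum>x\<in>S. (of_int (walsh f x))\<^sup>2)"
proof -
  let ?H = "tensor_power hadamard :: complex ^ (bit ^ 'n) ^ (bit ^ 'n)"
  define u where "u = ?H *v ket 0"
  define v where "v = ?H *v phase f u"
  \<comment> \<open>Here it matters that the third oracle equals the first: the second branch is
    then also an image under \<open>?H\<close>, which can be factored out.\<close>
  have "phase f u = ?H *v v"
    by (simp add: v_def matrix_vector_mul_assoc tensor_power_hadamard_involution)
  then have "?H *v phase g v - phase f u = ?H *v (phase g v - v)"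
    by (simp add: matrix_vector_mult_diff_distrib)
  then have "output_prob 1 f g f = (norm (phase g v - v))\<^sup>2 / 4"
    using output_prob_interference[of f g f] assms norm_tensor_power_hadamard[of "phase g v - v"]
    by (simp add: u_def v_def)
  also have "\<dots> = (\<Sum>x\<in>UNIV. if x \<in> S then (cmod (v $ x))\<^sup>2 else 0)"
  proof -
    \<comment> \<open>The 4 is the square of the modulus of -2 and cancels the 1/4 from the
      interference.\<close>
    have "(cmod ((phase g v - v) $ x))\<^sup>2 = 4 * (if x \<in> S then (cmod (v $ x))\<^sup>2 else 0)" for x
    proof (cases "x \<in> S")
      case True
      then have "(phase g v - v) $ x = - 2 * v $ x"
        by (simp add: phase_def assms(2))
      then show ?thesis
        using True by (simp only: norm_mult power_mult_distrib) simp
    qed (simp add: phase_def assms(2))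
    then show ?thesis
      by (simp only: norm_power2_vec sum_distrib_left[symmetric])
  qed
  also have "\<dots> = (\<Sum>x\<in>S. (of_int (walsh f x) / 2 ^ CARD('n))\<^sup>2)"
    by (simp add: sum.If_cases v_def u_def walsh_amplitude power_divide del: of_real_divide)
  also have "\<dots> = 1 / 2 ^ (2 * CARD('n)) * (\<Sum>x\<in>S. (of_int (walsh f x))\<^sup>2)"
    by (simp add: power_divide sum_divide_distrib power_even_eq)
  finally show ?thesis .
qed

end
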